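(* Let $0\le p<q$ be integers and let $\vec a\in(-1,\infty)^p$, $\vec b\in(-1,\infty)^q$ satisfy $a_j<b_j$ for $1\le j\le p$. Let $\vec n\in\mathbb Z_{\ge0}^q$ be a multi-index near the diagonal with $|\vec n|\ge1$. Then for every type I function $F_{\vec n}$ for the weights $(w_1,\dots,w_q)$ on the unit circle there is a constant $\mathcal F_{\vec n}\in\mathbb R$ such that, for every integer $s\ge1$, the $(s-1)$-th moment of $F_{\vec n}$ is $$\frac1{2\pi i}\int_{|z|=1}z^{s-1}F_{\vec n}(z)\,dz=\mathcal F_{\vec n}\cdot\frac{\Gamma(s+\vec a)}{\Gamma(s+\vec b+\vec n)}\,(1-s)_{|\vec n|-1}.$$
   Context: Conventions: for a vector $\vec s$, $\Gamma(\vec s)=\prod_j\Gamma(s_j)$ (equal to $1$ for the empty vector); adding a scalar to a vector means adding it to each component; $(s)_k=\prod_{i=0}^{k-1}(s+i)$; $|\vec n|=n_1+\dots+n_q$; $\vec e_j$ is the $j$-th unit vector. A multi-index is near the diagonal if $|n_i-n_j|\le1$ for all $i,j$. Weights: $w_j(z)=w_j(z;\vec a,\vec b)=\sum_{k\ge0}\frac{\Gamma(k+\vec a+1)}{\Gamma(k+\vec b+\vec e_j+1)}z^{-k-1}$ for $z\in\mathbb C\setminus\{0\}$, $1\le j\le q$; thus $\frac1{2\pi i}\int_{|z|=1}z^{s-1}w_j(z)dz=\Gamma(s+\vec a)/\Gamma(s+\vec b+\vec e_j)$ for integers $s\ge1$ (circle positively oriented). Type I function for $\vec n$: $F_{\vec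 n}=\sum_{j=1}^qA_{\vec n,j}w_j$ with real polynomials $\deg A_{\vec n,j}\le n_j-1$ ($A_{\vec n,j}=0$ if $n_j=0$) such that $\int_{|z|=1}F_{\vec n}(z)z^kdz=0$ for $k=0,\dots,|\vec n|-2$. *)

theory Defs
  imports "HOL-Complex_Analysis.Complex_Analysis"
begin

text \<open>
  Vectors of length \<open>m\<close> are functions on \<open>nat\<close>, of which only the values at \<open>1, \<dots>, m\<close> are used.
\<close>

definition Gamma_vec :: "nat \<Rightarrow> (nat \<Rightarrow> real) \<Rightarrow> real" where
  "Gamma_vec m v = (\<Prod>j=1..m. Gamma (v j))"

definition unit_vector :: "nat \<Rightarrow> nat \<Rightarrow> real" where
  "unit_vector j i = (if i = j then 1 else 0)"

definition mi_size :: "nat \<Rightarrow> (nat \<Rightarrow> nat) \<Rightarrow> nat" where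
  "mi_size q n = (\<Sum>j=1..q. n j)"

definition near_diagonal :: "nat \<Rightarrow> (nat \<Rightarrow> nat) \<Rightarrow> bool" where
  "near_diagonal q n \<longleftrightarrow> (\<forall>i\<in>{1..q}. \<forall>j\<in>{1..q}. \<bar>int (n i) - int (n j)\<bar> \<le> 1)"

text \<open>The values at \<open>z = 0\<close> have no meaning and are never used.\<close>

definition weight ::
    "nat \<Rightarrow> nat \<Rightarrow> (nat \<Rightarrow> real) \<Rightarrow> (nat \<Rightarrow> real) \<Rightarrow> nat \<Rightarrow> complex \<Rightarrow> complex" where
  "weight p q a b j z =
     (\<Sum>k. complex_of_real
            (Gamma_vec p (\<lambda>i. real k + a i + 1) /
             Gamma_vec q (\<lambda>i. real k + b i + unit_vector j i + 1)) *
          z powi (- int k - 1))"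

text \<open>
  \<open>F\<close> is a type I function for \<open>n\<close> and the weights \<open>w\<^sub>1, \<dots>, w\<^sub>q\<close> on the unit circle. It is a
  function on the punctured plane, so \<open>F 0\<close> is left unconstrained. The orthogonality range
  \<open>k \<le> mi_size q n - 2\<close> is written \<open>k + 2 \<le> mi_size q n\<close> to avoid truncated subtraction.
\<close>

definition type_I_function ::
    "nat \<Rightarrow> (nat \<Rightarrow> complex \<Rightarrow> complex) \<Rightarrow> (nat \<Rightarrow> nat) \<Rightarrow> (complex \<Rightarrow> complex) \<Rightarrow> bool" where
  "type_I_function q w n F \<longleftrightarrow>
     (\<exists>A :: nat \<Rightarrow> real poly.
        (\<forall>j\<in>{1..q}. if n j = 0 then A j = 0 else degree (A j) \<le> n j - 1) \<and>
        (\<forall>z. z \<noteq> 0 \<longrightarrow> F z = (\<Sum>j=1..q. poly (map_poly complex_of_real (A j)) z * w j z))) \<and>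
     (\<forall>k. k + 2 \<le> mi_size q n \<longrightarrow> contour_integral (circlepath 0 1) (\<lambda>z. F z * z ^ k) = 0)"

end

theory Submission imports Defs begin

text \<open>
  The \<open>(s - 1)\<close>-th moment of \<open>z\<^sup>l w\<^sub>j\<close> is \<open>\<Gamma>(s + l + a) / \<Gamma>(s + l + b + e\<^sub>j)\<close>. For
  \<open>l < n\<^sub>j\<close>, nearness to the diagonal gives \<open>l + \<delta>\<^sub>i\<^sub>j \<le> n\<^sub>i\<close> for all \<open>i\<close>, so this moment is
  \<open>\<Gamma>(s + a) / \<Gamma>(s + b + n)\<close> times a polynomial in \<open>s\<close> of degree
  \<open>p l + (|n| - q l - 1) \<le> |n| - 1\<close>. The moments of \<open>F\<close> have the same form, and
  orthogonality makes the polynomial vanish at \<open>s = 1, \<dots>, |n| - 1\<close>; hence it is a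
  multiple of \<open>(1 - s)\<close> to the rising power \<open>|n| - 1\<close>.
\<close>

section \<open>Termwise integration of Laurent series over the unit circle\<close>

text \<open>For \<open>m \<noteq> -1\<close> the integrand has the primitive
  \<open>z powi (m + 1) / (m + 1)\<close> on the punctured plane. The exceptional case is Cauchy's
  integral formula for the constant function 1.\<close>

lemma has_contour_integral_powi_circlepath:
  "((\<lambda>z. z powi m) has_contour_integral (if m = -1 then 2 * of_real pi * \<i> else 0)) (circlepath 0 1)"
proof (cases "m = -1")
  case True
  have "((\<lambda>z. 1 / (z - 0)) has_contour_integral 2 * of_real pi * \<i> * 1) (circlepath 0 1)"
    by (rule Cauchy_integral_circlepath_simple) auto
  then show ?thesis
    using True by (simp add: power_int_minus_divide)
next
  case False
  have "((\<lambda>z. z powi (m + 1) / of_int (m + 1)) has_field_derivative z powi m) (at z within - {0})"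
    if "z \<in> - {0}" for z :: complex
  proof -
    have "m + 1 \<noteq> 0" using False by simp
    then have "of_int (m + 1) \<noteq> (0 :: complex)" using of_int_eq_0_iff by blast
    then show ?thesis
      using that by (auto intro!: derivative_eq_intros simp del: of_int_add)
  qed
  then have "((\<lambda>z. z powi m) has_contour_integral 0) (circlepath 0 1)"
    by (rule Cauchy_theorem_primitive) auto
  then show ?thesis using False by simp
qed

text \<open>On the circle every power of \<open>z\<close> has modulus 1, so the M-test with the
  bounds \<open>norm (c k)\<close> gives uniform convergence and permits termwise integration. Only
  the term \<open>k = m\<close> has exponent -1 after multiplication by
  \<open>z ^ m\<close>.\<close>

lemma Laurent_tail_has_contour_integral:
  fixes c :: "nat \<Rightarrow> complex"
  assumes "summable (\<lambda>k. norm (c k))"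
  shows "((\<lambda>z. z ^ m * (\<Sum>k. c k * z powi (- int k - 1))) has_contour_integral
           2 * of_real pi * \<i> * c m) (circlepath 0 1)"
proof -
  define f where "f k z = z ^ m * (c k * z powi (- int k - 1))" for k and z :: complex
  define g where "g z = (\<Sum>k. f k z)" for z
  have norm_f: "norm (f k z) = norm (c k)" if "z \<in> sphere 0 1" for k z
    using that by (simp add: f_def norm_mult norm_power norm_power_int)
  have unif: "uniform_limit (sphere 0 1) (\<lambda>N z. \<Sum>k<N. f k z) g sequentially"
    unfolding g_def by (rule Weierstrass_m_test[OF _ assms]) (simp add: norm_f)
  have f_int: "(f k has_contour_integral (if k = m then 2 * of_real pi * \<i> * c m else 0))
                 (circlepath 0 1)" for k
  proof -
    have "((\<lambda>z. c k * z powi (int m - int k - 1)) has_contour_integral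
            c k * (if int m - int k - 1 = -1 then 2 * of_real pi * \<i> else 0)) (circlepath 0 1)"
      by (intro has_contour_integral_lmul has_contour_integral_powi_circlepath)
    moreover have "c k * z powi (int m - int k - 1) = f k z"
      if "z \<in> path_image (circlepath 0 1)" for z
    proof -
      have "z \<noteq> 0" using that by auto
      then have "z powi (int m + (- int k - 1)) = z ^ m * z powi (- int k - 1)"
        by (subst power_int_add) auto
      then show ?thesis by (simp add: f_def algebra_simps)
    qed
    ultimately have "(f k has_contour_integral
        c k * (if int m - int k - 1 = -1 then 2 * of_real pi * \<i> else 0)) (circlepath 0 1)"
      by (rule has_contour_integral_eq)
    then show ?thesis by (auto simp: mult_ac split: if_splits)
  qed
  have sum_int: "((\<lambda>z. \<Sum>k<N. f k z) has_contour_integral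
                   (\<Sum>k<N. if k = m then 2 * of_real pi * \<i> * c m else 0)) (circlepath 0 1)" for N
    by (intro has_contour_integral_sum f_int) auto
  have integrable: "\<forall>\<^sub>F N in sequentially. (\<lambda>z. \<Sum>k<N. f k z) contour_integrable_on circlepath 0 1"
    using sum_int has_contour_integral_integrable by (intro always_eventually) blast
  note lim = contour_integral_uniform_limit_circlepath[OF integrable unif]
  have "(\<lambda>N. contour_integral (circlepath 0 1) (\<lambda>z. \<Sum>k<N. f k z))
          \<longlonglongrightarrow> contour_integral (circlepath 0 1) g"
    by (intro lim(2)) auto
  moreover have "(\<lambda>N. contour_integral (circlepath 0 1) (\<lambda>z. \<Sum>k<N. f k z))
          \<longlonglongrightarrow> 2 * of_real pi * \<i> * c m"
    \<comment> \<open>The partial integrals are constant from \<open>N = m + 1\<close> on, once the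
      single nonzero term is included.\<close>
    by (rule tendsto_eventually, rule eventually_mono[OF eventually_gt_at_top[of m]])
       (simp add: contour_integral_unique[OF sum_int])
  ultimately have "contour_integral (circlepath 0 1) g = 2 * of_real pi * \<i> * c m"
    using LIMSEQ_unique by blast
  moreover have "g contour_integrable_on circlepath 0 1"
    by (intro lim(1)) auto
  ultimately have "(g has_contour_integral 2 * of_real pi * \<i> * c m) (circlepath 0 1)"
    using has_contour_integral_integral by metis
  then show ?thesis
  proof (rule has_contour_integral_eq)
    fix z assume "z \<in> path_image (circlepath 0 1)"
    then have z: "norm z = 1" by simp
    have "summable (\<lambda>k. c k * z powi (- int k - 1))"
      using assms by (intro summable_norm_cancel[where f = "\<lambda>k. c k * z powi (- int k - 1)"])
        (simp add: norm_mult norm_power_int z)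
    then show "g z = z ^ m * (\<Sum>k. c k * z powi (- int k - 1))"
      unfolding g_def f_def by (rule suminf_mult)
  qed
qed

section \<open>Coefficients of the weights: decay, moments and Gamma quotients\<close>

text \<open>The real coefficient of \<open>z powi (- k - 1)\<close> in \<open>weight\<close>; by
  termwise integration it is also the \<open>k\<close>-th moment.\<close>

definition weight_coeff ::
    "nat \<Rightarrow> nat \<Rightarrow> (nat \<Rightarrow> real) \<Rightarrow> (nat \<Rightarrow> real) \<Rightarrow> nat \<Rightarrow> nat \<Rightarrow> real" where
  "weight_coeff p q a b j k =
     Gamma_vec p (\<lambda>i. real k + a i + 1) /
     Gamma_vec q (\<lambda>i. real k + b i + unit_vector j i + 1)"

lemma Gamma_vec_pos:
  assumes "\<And>i. i \<in> {1..m} \<Longrightarrow> v i > 0"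
  shows "Gamma_vec m v > 0"
  unfolding Gamma_vec_def using assms by (intro prod_pos) (auto intro: Gamma_real_pos)

text \<open>This is the functional equation of Gamma applied \<open>d i\<close> times in component
  \<open>i\<close>; positivity keeps the arguments away from the poles.\<close>

lemma Gamma_vec_add_nat:
  assumes "\<And>i. i \<in> {1..m} \<Longrightarrow> v i > 0"
  shows "Gamma_vec m (\<lambda>i. v i + real (d i)) = Gamma_vec m v * (\<Prod>i=1..m. pochhammer (v i) (d i))"
proof -
  have "Gamma (v i + real (d i)) = Gamma (v i) * pochhammer (v i) (d i)" if "i \<in> {1..m}" for i
  proof -
    have "v i > 0" using assms[OF that] .
    then have "v i \<notin> \<int>\<^sub>\<le>\<^sub>0" "Gamma (v i) > 0"
      by (auto elim!: nonpos_Ints_cases intro: Gamma_real_pos)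
    then show ?thesis by (simp add: pochhammer_Gamma)
  qed
  then show ?thesis by (simp add: Gamma_vec_def prod.distrib)
qed

lemma unit_vector_nonneg: "unit_vector j i \<ge> 0"
  by (simp add: unit_vector_def)

context
  fixes p q :: nat and a b :: "nat \<Rightarrow> real"
  assumes pq: "p < q"
    and a: "\<forall>j\<in>{1..p}. a j > -1"
    and b: "\<forall>j\<in>{1..q}. b j > -1"
    and ab: "\<forall>j\<in>{1..p}. a j < b j"
begin

lemma weight_coeff_pos: "weight_coeff p q a b j k > 0"
proof -
  have "real k + a i + 1 > 0" if "i \<in> {1..p}" for i
    using bspec[OF a that] by simp
  moreover have "real k + b i + unit_vector j i + 1 > 0" if "i \<in> {1..q}" for i
    using bspec[OF b that] unit_vector_nonneg[of j i] by simp
  ultimately show ?thesis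
    unfolding weight_coeff_def by (intro divide_pos_pos Gamma_vec_pos) auto
qed

text \<open>By the functional equation the ratio of consecutive coefficients is a product of
  \<open>p\<close> factors over a product of \<open>q\<close> factors. The first \<open>p\<close>
  quotients are at most 1 because \<open>a i < b i\<close>, and \<open>p < q\<close> leaves at least
  one further denominator factor, which is at least 2 once \<open>k \<ge> 2\<close>. The ratio test
  then yields the absolute summability behind the moment formula.\<close>

lemma weight_coeff_Suc_le:
  assumes "k \<ge> 2"
  shows "weight_coeff p q a b j (Suc k) \<le> 1 / 2 * weight_coeff p q a b j k"
proof -
  define x where "x i = real k + a i + 1" for i
  define y where "y i = real k + b i + unit_vector j i + 1" for i
  have x: "x i > 0" if "i \<in> {1..p}" for i
    using bspec[OF a that] by (simp add: x_def)
  have y: "y i \<ge> 2" if "i \<in> {1..q}" for i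
    using bspec[OF b that] unit_vector_nonneg[of j i] assms by (simp add: y_def)
  have xy: "x i \<le> y i" if "i \<in> {1..p}" for i
    using bspec[OF ab that] unit_vector_nonneg[of j i] by (simp add: x_def y_def)
  have "Gamma_vec p (\<lambda>i. real (Suc k) + a i + 1) = Gamma_vec p x * (\<Prod>i=1..p. x i)"
    using Gamma_vec_add_nat[of p x "\<lambda>_. 1"] x by (simp add: x_def add_ac)
  moreover have "Gamma_vec q (\<lambda>i. real (Suc k) + b i + unit_vector j i + 1) =
      Gamma_vec q y * (\<Prod>i=1..q. y i)"
    using Gamma_vec_add_nat[of q y "\<lambda>_. 1"] y
    by (force simp: y_def add_ac)
  ultimately have eq: "weight_coeff p q a b j (Suc k) =
      weight_coeff p q a b j k * ((\<Prod>i=1..p. x i) / (\<Prod>i=1..q. y i))"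
    by (simp add: weight_coeff_def flip: x_def y_def)
  have split: "(\<Prod>i=1..q. y i) = (\<Prod>i=1..p. y i) * (\<Prod>i=p+1..q. y i)"
    using pq prod.ub_add_nat[of 1 p y "q - p"] by simp
  have "(\<Prod>i=1..p. x i) * 2 \<le> (\<Prod>i=1..p. y i) * (\<Prod>i=p+1..q. y i)"
  proof (intro mult_mono prod_mono)
    have "(2::real) \<le> 2 ^ (q - p)"
      using pq power_increasing[of 1 "q - p" "2::real"] by simp
    also have "\<dots> = (\<Prod>i=p+1..q. 2)" by simp
    also have "\<dots> \<le> (\<Prod>i=p+1..q. y i)" by (intro prod_mono) (use y in auto)
    finally show "2 \<le> (\<Prod>i=p+1..q. y i)" .
    have "y i \<ge> 2" if "i \<in> {1..p}" for i using that pq by (intro y) auto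
    then show "0 \<le> (\<Prod>i=1..p. y i)" by (intro prod_nonneg) force
  qed (use x xy less_imp_le in auto)
  moreover have "(\<Prod>i=1..q. y i) > 0"
    by (intro prod_pos) (use y in force)
  ultimately have "(\<Prod>i=1..p. x i) / (\<Prod>i=1..q. y i) \<le> 1 / 2"
    unfolding split[symmetric] by (simp add: field_simps)
  then have "weight_coeff p q a b j k * ((\<Prod>i=1..p. x i) / (\<Prod>i=1..q. y i))
      \<le> weight_coeff p q a b j k * (1 / 2)"
    using weight_coeff_pos[of j k] by (intro mult_left_mono) auto
  then show ?thesis unfolding eq by simp
qed

lemma weight_has_moment:
  "((\<lambda>z. z ^ m * weight p q a b j z) has_contour_integral
     2 * of_real pi * \<i> * of_real (weight_coeff p q a b j m)) (circlepath 0 1)"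
proof -
  have "summable (\<lambda>k. norm (weight_coeff p q a b j k))"
    by (rule summable_ratio_test[of "1 / 2" 2])
       (use weight_coeff_Suc_le[of _ j] less_imp_le[OF weight_coeff_pos] in auto)
  then have "summable (\<lambda>k. norm (complex_of_real (weight_coeff p q a b j k)))"
    by simp
  from Laurent_tail_has_contour_integral[OF this, of m] show ?thesis
    by (simp only: weight_def weight_coeff_def)
qed

text \<open>Raising each Gamma argument to a common level pulls out a factor independent of
  \<open>j\<close> and \<open>l\<close>. The numerator is shifted up by \<open>l\<close> from
  \<open>Suc s + a i\<close>, while the denominator still lacks
  \<open>n i - (l + (if i = j then 1 else 0))\<close> steps to reach
  \<open>Suc s + b i + n i\<close>. What remains are rising powers, polynomial in
  \<open>s\<close>.\<close>

lemma weight_coeff_eq_pochhammer: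
  assumes "\<And>i. i \<in> {1..q} \<Longrightarrow> l + (if i = j then 1 else 0) \<le> n i"
  shows "weight_coeff p q a b j (s + l) =
    Gamma_vec p (\<lambda>i. real (Suc s) + a i) / Gamma_vec q (\<lambda>i. real (Suc s) + b i + real (n i)) *
    ((\<Prod>i=1..p. pochhammer (real (Suc s) + a i) l) *
     (\<Prod>i=1..q. pochhammer (real (Suc s) + (real l + b i + unit_vector j i))
        (n i - (l + (if i = j then 1 else 0)))))"
proof -
  let ?d = "\<lambda>i. n i - (l + (if i = j then 1 else 0))"
  let ?y = "\<lambda>i. real (Suc s) + (real l + b i + unit_vector j i)"
  have x: "real (Suc s) + a i > 0" if "i \<in> {1..p}" for i
    using bspec[OF a that] by simp
  have num: "Gamma_vec p (\<lambda>i. real (s + l) + a i + 1) =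
      Gamma_vec p (\<lambda>i. real (Suc s) + a i) * (\<Prod>i=1..p. pochhammer (real (Suc s) + a i) l)"
    using Gamma_vec_add_nat[of p "\<lambda>i. real (Suc s) + a i" "\<lambda>_. l"] x by (simp add: add_ac)
  have y: "?y i > 0" if "i \<in> {1..q}" for i
    using bspec[OF b that] unit_vector_nonneg[of j i] by simp
  have "Gamma_vec q (\<lambda>i. real (Suc s) + b i + real (n i)) = Gamma_vec q (\<lambda>i. ?y i + real (?d i))"
    unfolding Gamma_vec_def
  proof (intro prod.cong refl arg_cong[where f = Gamma])
    fix i assume "i \<in> {1..q}"
    \<comment> \<open>The assumed inequality makes the truncated subtraction in \<open>?d\<close>
      exact.\<close>
    from assms[OF this] show "real (Suc s) + b i + real (n i) = ?y i + real (?d i)"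
      by (auto simp: unit_vector_def of_nat_diff)
  qed
  also have "\<dots> = Gamma_vec q ?y * (\<Prod>i=1..q. pochhammer (?y i) (?d i))"
    by (rule Gamma_vec_add_nat) (rule y)
  finally have den: "Gamma_vec q (\<lambda>i. real (Suc s) + b i + real (n i)) =
      Gamma_vec q ?y * (\<Prod>i=1..q. pochhammer (?y i) (?d i))" .
  have "(\<lambda>i. real (s + l) + b i + unit_vector j i + 1) = ?y"
    by auto
  moreover have "(\<Prod>i=1..q. pochhammer (?y i) (?d i)) > 0"
    by (intro prod_pos) (use y in \<open>auto intro: pochhammer_pos\<close>)
  ultimately show ?thesis
    unfolding weight_coeff_def num den by (simp del: of_nat_Suc of_nat_add prod_zero_iff)
qed

end

section \<open>Rising powers as polynomials\<close>

lemma pochhammer_poly: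
  fixes c :: real
  shows "\<exists>P. degree P \<le> d \<and> (\<forall>x. poly P x = pochhammer (x + c) d)"
proof (intro exI conjI allI)
  let ?P = "\<Prod>h<d. [:c + real h, 1:]"
  show "degree ?P \<le> d"
    using degree_prod_sum_le[of "{..<d}" "\<lambda>h. [:c + real h, 1:]"] by simp
  show "poly ?P x = pochhammer (x + c) d" for x
    by (simp add: poly_prod pochhammer_prod add_ac atLeast0LessThan)
qed

lemma prod_pochhammer_poly:
  fixes c :: "'i \<Rightarrow> real"
  assumes "finite I"
  shows "\<exists>P. degree P \<le> (\<Sum>i\<in>I. d i) \<and> (\<forall>x. poly P x = (\<Prod>i\<in>I. pochhammer (x + c i) (d i)))"
proof -
  obtain P where P: "\<And>i. degree (P i) \<le> d i" "\<And>i x. poly (P i) x = pochhammer (x + c i) (d i)"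
    using pochhammer_poly[of "d i" "c i" for i] by metis
  have "degree (\<Prod>i\<in>I. P i) \<le> (\<Sum>i\<in>I. degree (P i))"
    using degree_prod_sum_le[OF assms, of P] by (simp add: comp_def)
  also have "\<dots> \<le> (\<Sum>i\<in>I. d i)" by (intro sum_mono P)
  finally show ?thesis by (intro exI[of _ "\<Prod>i\<in>I. P i"]) (simp add: poly_prod P)
qed

text \<open>Both sides are polynomials of degree at most \<open>d\<close> that agree at the
  \<open>d + 1\<close> points \<open>0, ..., d\<close>: both vanish at \<open>1, ..., d\<close>, and
  the factor \<open>poly P 0 / fact d\<close> matches the values at 0, where the rising power is
  \<open>fact d\<close>.\<close>

lemma poly_eq_pochhammer_of_roots:
  fixes P :: "real poly"
  assumes "degree P \<le> d" "\<And>k. 1 \<le> k \<Longrightarrow> k \<le> d \<Longrightarrow> poly P (real k) = 0"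
  shows "poly P x = poly P 0 / fact d * pochhammer (1 - x) d"
proof -
  let ?Q = "\<Prod>h<d. [:1 + real h, -1:]"
  have Q: "poly ?Q x = pochhammer (1 - x) d" for x
    by (simp add: poly_prod pochhammer_prod atLeast0LessThan algebra_simps)
  have "degree ?Q \<le> d"
    using degree_prod_sum_le[of "{..<d}" "\<lambda>h. [:1 + real h, -1:]"] by simp
  have "P = smult (poly P 0 / fact d) ?Q"
  proof (rule poly_eqI_degree[of "real ` {0..d}"])
    fix x assume "x \<in> real ` {0..d}"
    then obtain k where k: "x = real k" "k \<le> d" by auto
    show "poly P x = poly (smult (poly P 0 / fact d) ?Q) x"
    proof (cases "k = 0")
      case True
      then show ?thesis using k by (simp add: Q pochhammer_fact[symmetric] del: poly_prod)
    next
      case False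
      \<comment> \<open>Since \<open>k - 1 < d\<close>, the rising power starting at
        \<open>-(k - 1)\<close> contains the factor 0.\<close>
      then have "1 - real k = - real (k - 1)" by (simp add: of_nat_diff)
      then have "pochhammer (1 - real k) d = 0"
        using False k by (simp only: pochhammer_of_nat_eq_0_iff)
      then show ?thesis using k False assms(2)[of k] by (simp del: poly_prod add: Q)
    qed
  qed (use assms \<open>degree ?Q \<le> d\<close> in \<open>auto simp: card_image\<close>)
  then show ?thesis by (metis Q poly_smult)
qed

theorem theorem4p3:
  fixes p q :: nat and a b :: "nat \<Rightarrow> real" and n :: "nat \<Rightarrow> nat"
  assumes "p < q"
    and "\<forall>j\<in>{1..p}. a j > -1"
    and "\<forall>j\<in>{1..q}. b j > -1"
    and "\<forall>j\<in>{1..p}. a j < b j"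
    and "near_diagonal q n"
    and "mi_size q n \<ge> 1"
  shows "\<forall>F. type_I_function q (weight p q a b) n F \<longrightarrow>
    (\<exists>C :: real. \<forall>s :: nat. s \<ge> 1 \<longrightarrow>
       1 / (2 * complex_of_real pi * \<i>) *
         contour_integral (circlepath 0 1) (\<lambda>z. z ^ (s - 1) * F z) =
       complex_of_real
         (C * (Gamma_vec p (\<lambda>j. real s + a j) / Gamma_vec q (\<lambda>j. real s + b j + real (n j))) *
          pochhammer (1 - real s) (mi_size q n - 1)))"
proof (intro allI impI)
  fix F assume F: "type_I_function q (weight p q a b) n F"
  define N where "N = mi_size q n"
  define G where "G s = Gamma_vec p (\<lambda>j. real s + a j) / Gamma_vec q (\<lambda>j. real s + b j + real (n j))"
    for s :: nat
  obtain A where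
    A_deg: "\<And>j. j \<in> {1..q} \<Longrightarrow> if n j = 0 then A j = 0 else degree (A j) \<le> n j - 1" and
    F_eq: "\<And>z. z \<noteq> 0 \<Longrightarrow>
      F z = (\<Sum>j=1..q. poly (map_poly complex_of_real (A j)) z * weight p q a b j z)" and
    orth: "\<And>k. k + 2 \<le> N \<Longrightarrow> contour_integral (circlepath 0 1) (\<lambda>z. F z * z ^ k) = 0"
    using F unfolding type_I_function_def N_def by blast
  \<comment> \<open>Summing over \<open>l < n j\<close> also covers \<open>n j = 0\<close>, where
    the sum is empty and \<open>A j = 0\<close>.\<close>
  have A: "poly (map_poly complex_of_real (A j)) z = (\<Sum>l<n j. of_real (coeff (A j) l) * z ^ l)"
    if "j \<in> {1..q}" for j z
  proof (cases "n j = 0")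
    case True
    then show ?thesis using A_deg[OF that] by simp
  next
    case False
    then have "degree (A j) \<le> n j - 1" using A_deg[OF that] by simp
    then have "{..degree (A j)} \<subseteq> {..<n j}" using False by auto
    then have "(\<Sum>l\<le>degree (A j). complex_of_real (coeff (A j) l) * z ^ l) =
        (\<Sum>l<n j. complex_of_real (coeff (A j) l) * z ^ l)"
      by (intro sum.mono_neutral_left) (auto intro: coeff_eq_0)
    then show ?thesis by (simp add: poly_altdef coeff_map_poly degree_map_poly)
  qed
  \<comment> \<open>\<open>M m\<close> is the \<open>m\<close>-th moment of \<open>F\<close>:
    multiplying by \<open>z ^ l\<close> shifts the moments of each weight by
    \<open>l\<close>.\<close>
  define M where "M m = (\<Sum>j=1..q. \<Sum>l<n j. coeff (A j) l * weight_coeff p q a b j (m + l))" for m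
  have moment: "((\<lambda>z. z ^ m * F z) has_contour_integral 2 * of_real pi * \<i> * of_real (M m))
                  (circlepath 0 1)" for m
  proof -
    have "((\<lambda>z. \<Sum>j=1..q. \<Sum>l<n j. of_real (coeff (A j) l) * (z ^ (m + l) * weight p q a b j z))
        has_contour_integral (\<Sum>j=1..q. \<Sum>l<n j. of_real (coeff (A j) l) *
          (2 * of_real pi * \<i> * of_real (weight_coeff p q a b j (m + l))))) (circlepath 0 1)"
      using assms
      by (intro has_contour_integral_sum has_contour_integral_lmul weight_has_moment) auto
    also have "(\<Sum>j=1..q. \<Sum>l<n j. of_real (coeff (A j) l) *
          (2 * of_real pi * \<i> * of_real (weight_coeff p q a b j (m + l)))) =
        2 * of_real pi * \<i> * of_real (M m)"
      by (simp add: M_def sum_distrib_left mult_ac)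
    finally show ?thesis
    proof (rule has_contour_integral_eq)
      fix z assume "z \<in> path_image (circlepath 0 1)"
      then have "z \<noteq> 0" by auto
      then show "(\<Sum>j=1..q. \<Sum>l<n j. of_real (coeff (A j) l) * (z ^ (m + l) * weight p q a b j z)) =
          z ^ m * F z"
        by (simp add: F_eq A sum_distrib_left sum_distrib_right power_add mult_ac)
    qed
  qed
  have "\<exists>P. degree P \<le> N - 1 \<and>
      (\<forall>s. weight_coeff p q a b j (s + l) = G (Suc s) * poly P (real (Suc s)))"
    if j: "j \<in> {1..q}" and l: "l < n j" for j l
  proof -
    let ?e = "\<lambda>i. if i = j then 1 else 0 :: nat"
    \<comment> \<open>For \<open>i = j\<close> this is \<open>l < n j\<close>; for
      \<open>i \<noteq> j\<close> nearness to the diagonal gives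
      \<open>n i \<ge> n j - 1 \<ge> l\<close>.\<close>
    have le: "l + ?e i \<le> n i" if "i \<in> {1..q}" for i
    proof -
      have "\<bar>int (n i) - int (n j)\<bar> \<le> 1"
        using assms(5) that j by (auto simp: near_diagonal_def)
      then show ?thesis using l by auto
    qed
    obtain P1 where P1: "degree P1 \<le> p * l"
        "\<And>x. poly P1 x = (\<Prod>i=1..p. pochhammer (x + a i) l)"
      using prod_pochhammer_poly[of "{1..p}" "\<lambda>_. l" a] by auto
    obtain P2 where P2: "degree P2 \<le> (\<Sum>i=1..q. n i - (l + ?e i))"
        "\<And>x. poly P2 x =
          (\<Prod>i=1..q. pochhammer (x + (real l + b i + unit_vector j i)) (n i - (l + ?e i)))"
      using prod_pochhammer_poly[of "{1..q}" "\<lambda>i. n i - (l + ?e i)"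
          "\<lambda>i. real l + b i + unit_vector j i"] by auto
    have "(\<Sum>i=1..q. n i - (l + ?e i)) + (\<Sum>i=1..q. l + ?e i) = N"
      unfolding sum.distrib[symmetric] N_def mi_size_def
      by (intro sum.cong) (use le in auto)
    moreover have "(\<Sum>i=1..q. l + ?e i) = q * l + 1"
      using j by (subst sum.distrib) simp
    moreover have "p * l \<le> q * l" using assms(1) by (intro mult_right_mono) auto
    \<comment> \<open>The degree is at most \<open>p * l + (N - q * l - 1)\<close>, and
      \<open>p < q\<close> absorbs the contribution of the numerator.\<close>
    ultimately have "degree (P1 * P2) \<le> N - 1"
      using degree_mult_le[of P1 P2] P1(1) P2(1) by linarith
    then show ?thesis
      using weight_coeff_eq_pochhammer[OF assms(1-4) le]
      by (intro exI[of _ "P1 * P2"]) (simp add: P1(2) P2(2) G_def)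
  qed
  then obtain P where P: "\<And>j l. j \<in> {1..q} \<Longrightarrow> l < n j \<Longrightarrow> degree (P j l) \<le> N - 1"
    "\<And>j l s. j \<in> {1..q} \<Longrightarrow> l < n j \<Longrightarrow>
       weight_coeff p q a b j (s + l) = G (Suc s) * poly (P j l) (real (Suc s))"
    by metis
  \<comment> \<open>The factor \<open>G\<close> is the same for all \<open>j\<close> and
    \<open>l\<close>, so the linear combination acts on the polynomial parts only.\<close>
  define R where "R = (\<Sum>j=1..q. \<Sum>l<n j. smult (coeff (A j) l) (P j l))"
  have M: "M m = G (Suc m) * poly R (real (Suc m))" for m
    by (simp add: M_def R_def poly_sum P(2) sum_distrib_left mult_ac)
  have "degree R \<le> N - 1"
    unfolding R_def
    by (intro degree_sum_le finite_atLeastAtMost finite_lessThan order.trans[OF degree_smult_le] P(1)) auto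
  moreover have "poly R (real k) = 0" if "1 \<le> k" "k \<le> N - 1" for k
  proof -
    obtain m where m: "k = Suc m" using \<open>1 \<le> k\<close> by (cases k) auto
    \<comment> \<open>With \<open>k = m + 1\<close>, the range \<open>k \<le> N - 1\<close> is
      exactly the orthogonality range \<open>m + 2 \<le> N\<close>.\<close>
    have "2 * of_real pi * \<i> * complex_of_real (M m) = 0"
      using orth[of m] contour_integral_unique[OF moment[of m]] that m by (simp add: mult.commute)
    then have "M m = 0" by simp
    \<comment> \<open>Nonvanishing of \<open>G\<close> transfers the zero of the moment to
      \<open>R\<close>.\<close>
    moreover have "G (Suc m) > 0"
      unfolding G_def
    proof (intro divide_pos_pos Gamma_vec_pos)
      show "real (Suc m) + a i > 0" if "i \<in> {1..p}" for i
        using bspec[OF assms(2) that] by simp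
      show "real (Suc m) + b i + real (n i) > 0" if "i \<in> {1..q}" for i
        using bspec[OF assms(3) that] by simp
    qed
    ultimately show ?thesis using M[of m] m by simp
  qed
  ultimately have R: "poly R x = poly R 0 / fact (N - 1) * pochhammer (1 - x) (N - 1)" for x
    by (rule poly_eq_pochhammer_of_roots)
  show "\<exists>C :: real. \<forall>s :: nat. s \<ge> 1 \<longrightarrow>
       1 / (2 * complex_of_real pi * \<i>) *
         contour_integral (circlepath 0 1) (\<lambda>z. z ^ (s - 1) * F z) =
       complex_of_real
         (C * (Gamma_vec p (\<lambda>j. real s + a j) / Gamma_vec q (\<lambda>j. real s + b j + real (n j))) *
          pochhammer (1 - real s) (mi_size q n - 1))"
  proof (intro exI[of _ "poly R 0 / fact (N - 1)"] allI impI)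
    fix s :: nat assume "s \<ge> 1"
    then have "M (s - 1) = G s * poly R (real s)"
      using M[of "s - 1"] by simp
    also have "\<dots> = poly R 0 / fact (N - 1) * G s * pochhammer (1 - real s) (N - 1)"
      by (subst R) (simp only: mult_ac)
    finally have "1 / (2 * complex_of_real pi * \<i>) *
        contour_integral (circlepath 0 1) (\<lambda>z. z ^ (s - 1) * F z) =
        complex_of_real (poly R 0 / fact (N - 1) * G s * pochhammer (1 - real s) (N - 1))"
      by (simp add: contour_integral_unique[OF moment])
    then show "1 / (2 * complex_of_real pi * \<i>) *
        contour_integral (circlepath 0 1) (\<lambda>z. z ^ (s - 1) * F z) =
        complex_of_real (poly R 0 / fact (N - 1) *
          (Gamma_vec p (\<lambda>j. real s + a j) / Gamma_vec q (\<lambda>j. real s + b j + real (n j))) *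
          pochhammer (1 - real s) (mi_size q n - 1))"
      by (simp only: G_def N_def)
  qed
qed

end
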